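(* Let $d\ge 2$ and let $\mathbf X=R\mathbf U$ be a random vector in $\mathbb R^d$ satisfying Assumptions (A1), (A2), (A3) and (A4) listed in the context. Let $$\tilde S=\bigcap\Big\{A\in\mathcal A:\ \lim_{k\to\infty} g(k,A)<\lim_{k\to\infty} g(k,A^c)\Big\}.$$ Then $S=\mathrm{cl}(\tilde S)$. Furthermore, for all $\delta>0$, $$\lim_{k\to\infty}\frac{\log \mathbb P(R>k,\ \mathbf U\in \tilde S^\delta)}{\log \mathbb P(R>k)}=1 \qquad\text{and}\qquad \lim_{k\to\infty}\frac{\log \mathbb P(R>k,\ \mathbf U\in (\tilde S^\delta)^c)}{\log \mathbb P(R>k)}>1 .$$
   Context: Setting. $\|\cdot\|$ is an $l_p$ norm on $\mathbb R^d$ with $1\le p<\infty$, and $\mathbb S^{d-1}=\{\mathbf x\in\mathbb R^d:\|\mathbf x\|=1\}$. The random vector $\mathbf X$ is written $\mathbf X=R\mathbf U$ with $R=\|\mathbf X\|$ and $\mathbf U=\mathbf X/\|\mathbf X\|$. The sphere $\mathbb S^{d-1}$ carries the geodesic metric: $\mathrm{dist}(\mathbf x,\mathbf y)$ is the length (measured in $\|\cdot\|$) of the shortest geodesic (curve) in $\mathbb S^{d-1}$ connecting $\mathbf x$ and $\mathbf y$. Open balls $B(\mathbf x,r)=\{\mathbf y\in\mathbb S^{d-1}:\mathrm{dist}(\mathbf x,\mathbf y)<r\}$ ($r>0$), open sets, closure $\mathrm{cl}(\cdot)=\overline{\,\cdot\,}$ and Borel sets are with respect to this metric; complements $A^c$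 of subsets of $\mathbb S^{d-1}$ are taken in $\mathbb S^{d-1}$. For $A\subset\mathbb S^{d-1}$ and $\delta>0$, $A^\delta=\{\mathbf x\in\mathbb S^{d-1}:\inf_{\mathbf a\in A}\mathrm{dist}(\mathbf x,\mathbf a)<\delta\}$. Convention: $\log 0=-\infty$, so a quotient of $\log 0$ by a negative number is $+\infty$. Definition of $g$. Let $k_R=\sup\{k:\mathbb P(R>k)=1\}$. For $k>k_R$ and Borel $A\subset\mathbb S^{d-1}$, $$g(k,A)=\frac{\log \mathbb P(R>k,\mathbf U\in A)}{\log \mathbb P(R>k)}\in[0,\infty].$$ Definition of $S$. $S$ is the set of all $\mathbf x\in\mathbb S^{d-1}$ such that for every $\varepsilon>0$: $\mathbb P(\mathbf U\in B(\mathbf x,\varepsilon))>0$ and $\lim_{k\to\infty}\frac{\log \mathbb P(R>k\mid \mathbf U\in B(\mathbf x,\varepsilon))}{\log\mathbb P(R>k)}=1$. Assumptions. (A1) $R$ is a positive random variable with $\mathbb P(R>k)>0$ for all $k\in\mathbb R$, and $\lim_{k\to\infty}-\log(\mathbb P(R>k))/k=0$. (A2) There is a fixed number $k_0>0$ (not depending on $A$) such that for every Borel set $A\subset\mathbb S^{d-1}$ the quantity $\mathbb P(\mathbf U\in A\mid R>k)$ is constant for all $k>k_0$. (In particular the limit distribution of $\mathbf U\mid R>k$ as $k\to\infty$ exists.) (A3) $\lim_{k\to\infty}g(k,A)$ exists in $[0,\infty]$ for every Borel set $A\subset\mathbb S^{d-1}$. (A4) $S^c$ contains a nonempty open set, and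 $S=\overline{T_1}\cup T_2$, where $T_1$ is a (possibly empty) open subset of $\mathbb S^{d-1}$ and $T_2$ is a (possibly empty) finite set of points of $\mathbb S^{d-1}$, each of which has positive mass under the limit distribution of $\mathbf U\mid R>k$ as $k\to\infty$. Testing sets. $\mathcal A$ is the collection of all sets $A\subset\mathbb S^{d-1}$ such that $A$ is a finite union of open balls and, for all $\mathbf x\in A^c$ and all $\varepsilon>0$, the ball $B(\mathbf x,\varepsilon)$ contains an open ball $B$ with $B\subset A^c$ (the point $\mathbf x$ need not lie in $B$). *)

theory Defs
  imports "HOL-Probability.Probability"
begin

definition lp_norm :: "real \<Rightarrow> real^'n \<Rightarrow> real" where
  "lp_norm p x = (\<Sum>i\<in>UNIV. \<bar>x $ i\<bar> powr p) powr (1 / p)"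

definition lp_sphere :: "real \<Rightarrow> (real^'n) set" where
  "lp_sphere p = {x. lp_norm p x = 1}"

text \<open>Length of a curve measured in the \<open>l\<^sub>p\<close> norm: the supremum of the lengths of the
  inscribed polygons over all subdivisions \<open>0 = t 0 \<le> \<dots> \<le> t n = 1\<close>.\<close>

definition lp_length :: "real \<Rightarrow> (real \<Rightarrow> real^'n) \<Rightarrow> ereal" where
  "lp_length p \<gamma> =
     (SUP (n, t) \<in> {(n :: nat, t :: nat \<Rightarrow> real). mono_on {..n} t \<and> t 0 = 0 \<and> t n = 1}.
        ereal (\<Sum>i<n. lp_norm p (\<gamma> (t (Suc i)) - \<gamma> (t i))))"

text \<open>The infimum is attained and finite on the sphere in dimension at least 2, where any two
  points are joined by a rectifiable curve in the sphere.\<close>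

definition geo_dist :: "real \<Rightarrow> real^'n \<Rightarrow> real^'n \<Rightarrow> real" where
  "geo_dist p x y =
     real_of_ereal (INF \<gamma> \<in> {\<gamma>. path \<gamma> \<and> path_image \<gamma> \<subseteq> lp_sphere p \<and>
                                  pathstart \<gamma> = x \<and> pathfinish \<gamma> = y}. lp_length p \<gamma>)"

definition geo_ball :: "real \<Rightarrow> real^'n \<Rightarrow> real \<Rightarrow> (real^'n) set" where
  "geo_ball p x r = Metric_space.mball (lp_sphere p) (geo_dist p) x r"

definition geo_top :: "real \<Rightarrow> (real^'n) topology" where
  "geo_top p = Metric_space.mtopology (lp_sphere p) (geo_dist p)"

definition geo_borel :: "real \<Rightarrow> (real^'n) set set" where
  "geo_borel p = sigma_sets (lp_sphere p) {V. openin (geo_top p) V}"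

text \<open>The infimum is taken in the extended reals, so that the enlargement of the empty set is
  empty.\<close>

definition geo_enlarge :: "real \<Rightarrow> real \<Rightarrow> (real^'n) set \<Rightarrow> (real^'n) set" where
  "geo_enlarge p \<delta> A = {x \<in> lp_sphere p. (INF a\<in>A. ereal (geo_dist p x a)) < ereal \<delta>}"

definition testing_sets :: "real \<Rightarrow> (real^'n) set set" where
  "testing_sets p =
     {A. (\<exists>F. finite F \<and> (\<forall>(c, r)\<in>F. c \<in> lp_sphere p \<and> 0 < r) \<and> A = (\<Union>(c, r)\<in>F. geo_ball p c r)) \<and>
         (\<forall>x \<in> lp_sphere p - A. \<forall>\<epsilon>>0. \<exists>y \<in> lp_sphere p. \<exists>r>0.
            geo_ball p y r \<subseteq> geo_ball p x \<epsilon> \<and> geo_ball p y r \<subseteq> lp_sphere p - A)}"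

definition radius :: "real \<Rightarrow> ('w \<Rightarrow> real^'n) \<Rightarrow> 'w \<Rightarrow> real" where
  "radius p X \<omega> = lp_norm p (X \<omega>)"

definition angle :: "real \<Rightarrow> ('w \<Rightarrow> real^'n) \<Rightarrow> 'w \<Rightarrow> real^'n" where
  "angle p X \<omega> = X \<omega> /\<^sub>R radius p X \<omega>"

definition elog :: "real \<Rightarrow> ereal" where
  "elog x = (if x = 0 then - \<infinity> else ereal (ln x))"

text \<open>The quotient is meaningful once \<open>k\<close> exceeds \<open>sup {k. \<P>(R > k) = 1}\<close>, where the
  denominator is negative; only its limit as \<open>k \<rightarrow> \<infinity>\<close> is ever used.\<close>

definition g_quot :: "'w measure \<Rightarrow> real \<Rightarrow> ('w \<Rightarrow> real^'n) \<Rightarrow> real \<Rightarrow> (real^'n) set \<Rightarrow> ereal" where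
  "g_quot M p X k A =
     elog \<P>(\<omega> in M. radius p X \<omega> > k \<and> angle p X \<omega> \<in> A) / elog \<P>(\<omega> in M. radius p X \<omega> > k)"

definition S_set :: "'w measure \<Rightarrow> real \<Rightarrow> ('w \<Rightarrow> real^'n) \<Rightarrow> (real^'n) set" where
  "S_set M p X =
     {x \<in> lp_sphere p. \<forall>\<epsilon>>0.
        \<P>(\<omega> in M. angle p X \<omega> \<in> geo_ball p x \<epsilon>) > 0 \<and>
        ((\<lambda>k. elog \<P>(\<omega> in M. radius p X \<omega> > k \<bar> angle p X \<omega> \<in> geo_ball p x \<epsilon>)
               / elog \<P>(\<omega> in M. radius p X \<omega> > k)) \<longlongrightarrow> 1) at_top}"

text \<open>The whole sphere always belongs to the intersected family, so the intersection is a subset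
  of the sphere.\<close>

definition S_tilde :: "'w measure \<Rightarrow> real \<Rightarrow> ('w \<Rightarrow> real^'n) \<Rightarrow> (real^'n) set" where
  "S_tilde M p X =
     \<Inter>{A \<in> testing_sets p. \<exists>L L'.
          ((\<lambda>k. g_quot M p X k A) \<longlongrightarrow> L) at_top \<and>
          ((\<lambda>k. g_quot M p X k (lp_sphere p - A)) \<longlongrightarrow> L') at_top \<and> L < L'}"

end

theory Submission
  imports Defs
begin

text \<open>By (A2), \<open>g(k, A)\<close> tends to \<open>1\<close> if \<open>A\<close> has positive mass under the law \<open>N\<close> of \<open>U\<close> given
  \<open>R > k\<close> (\<open>k\<close> large), and to \<open>\<infinity>\<close> otherwise. Hence \<open>S\<close> is the support of \<open>N\<close>, and the testing sets
  that are intersected are those of full mass. Such a set contains all atoms, and it contains \<open>T\<^sub>1\<close>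
  because a point of \<open>T\<^sub>1\<close> outside it would be approached by null balls inside \<open>S\<close>. Conversely, \<open>S\<close> is
  cut out by unions of equal balls centred on a finite net of \<open>S\<close>; for all but countably many radii
  such a union is a testing set. The geodesic topology is compact because a short chord, projected
  radially to the sphere, is a curve of comparable length.\<close>

subsection \<open>The norm and the length of curves\<close>

text \<open>For positive \<open>u\<close> and \<open>v\<close> this is convexity of the power
  function; if one of them is 0, it reduces to \<open>r powr p \<le> r\<close> for \<open>r\<close>
  in [0, 1].\<close>

lemma powr_convex_nonneg:
  fixes p s t u v :: real
  assumes "1 \<le> p" "0 \<le> s" "0 \<le> t" "s + t = 1" "0 \<le> u" "0 \<le> v"
  shows "(s * u + t * v) powr p \<le> s * u powr p + t * v powr p"
proof -
  have scaled: "(r * w) powr p \<le> r * w powr p" if "0 \<le> r" "r \<le> 1" "0 \<le> w" for r w :: real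
  proof -
    have "r powr p \<le> r powr 1"
      using assms(1) that by (intro powr_mono') auto
    then show ?thesis
      using that by (simp add: powr_mult mult_right_mono)
  qed
  consider "u = 0" | "v = 0" | "0 < u" "0 < v"
    using assms by linarith
  then show ?thesis
  proof cases
    case 3
    moreover have "s = 1 - t"
      using assms by simp
    ultimately show ?thesis
      using convex_onD[OF powr_convex[OF assms(1)], of t u v] assms(2,3) by simp
  qed (use scaled[of t v] scaled[of s u] assms in auto)
qed

section \<open>The l_p norm and its unit sphere\<close>

context
  fixes p :: real
  assumes p: "1 \<le> p"
begin

lemma lp_norm_nonneg [simp]: "0 \<le> lp_norm p x"
  by (simp add: lp_norm_def)

lemma lp_norm_powr: "lp_norm p x powr p = (\<Sum>i\<in>UNIV. \<bar>x $ i\<bar> powr p)"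
  using p by (simp add: lp_norm_def powr_powr sum_nonneg)

lemma lp_norm_eq_0_iff [simp]: "lp_norm p x = 0 \<longleftrightarrow> x = 0"
  using p by (simp add: lp_norm_def sum_nonneg_eq_0_iff vec_eq_iff)

lemma component_le_lp_norm: "\<bar>x $ i\<bar> \<le> lp_norm p x"
proof -
  have "\<bar>x $ i\<bar> powr p \<le> lp_norm p x powr p"
    unfolding lp_norm_powr by (rule member_le_sum) auto
  then show ?thesis
    using p by (smt (verit) lp_norm_nonneg powr_less_mono2)
qed

lemma lp_norm_scaleR: "lp_norm p (c *\<^sub>R x) = \<bar>c\<bar> * lp_norm p x"
  using p by (simp add: lp_norm_def abs_mult powr_mult powr_powr sum_nonneg flip: sum_distrib_left)

lemma lp_norm_minus [simp]: "lp_norm p (- x) = lp_norm p x"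
  by (simp add: lp_norm_def)

lemma lp_norm_minus_commute: "lp_norm p (x - y) = lp_norm p (y - x)"
  by (metis lp_norm_minus minus_diff_eq)

text \<open>Minkowski's inequality: (x + y)/(a + b) is the convex combination of the unit vectors
  x/a and y/b with weights \<open>s\<close> and \<open>t\<close>. Convexity of the power applies in
  each coordinate, and summation over the coordinates leaves \<open>s + t = 1\<close>.\<close>

lemma lp_norm_triangle: "lp_norm p (x + y) \<le> lp_norm p x + lp_norm p y"
proof (cases "x = 0 \<or> y = 0")
  case False
  define a b where "a = lp_norm p x" and "b = lp_norm p y"
  have ab: "0 < a" "0 < b"
    using False by (auto simp: a_def b_def less_le)
  define s t where "s = a / (a + b)" and "t = b / (a + b)"
  have st: "0 \<le> s" "0 \<le> t" "s + t = 1"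
    using ab by (auto simp: s_def t_def simp flip: add_divide_distrib)
  have "\<bar>(x + y) $ i\<bar> powr p \<le> (a + b) powr p * (s * (\<bar>x $ i\<bar> powr p / a powr p) + t * (\<bar>y $ i\<bar> powr p / b powr p))" for i
  proof -
    have "\<bar>(x + y) $ i\<bar> \<le> (a + b) * (s * (\<bar>x $ i\<bar> / a) + t * (\<bar>y $ i\<bar> / b))"
    proof -
      have "(a + b) * s = a" "(a + b) * t = b"
        using ab by (simp_all add: s_def t_def)
      then have "(a + b) * (s * (\<bar>x $ i\<bar> / a) + t * (\<bar>y $ i\<bar> / b)) = \<bar>x $ i\<bar> + \<bar>y $ i\<bar>"
        using ab by (simp only: distrib_left mult.assoc[symmetric]) simp
      then show ?thesis
        by simp
    qed
    then have "\<bar>(x + y) $ i\<bar> powr p \<le> ((a + b) * (s * (\<bar>x $ i\<bar> / a) + t * (\<bar>y $ i\<bar> / b))) powr p"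
      using p by (intro powr_mono2) auto
    also have "\<dots> = (a + b) powr p * (s * (\<bar>x $ i\<bar> / a) + t * (\<bar>y $ i\<bar> / b)) powr p"
      by (rule powr_mult)
    also have "\<dots> \<le> (a + b) powr p * (s * (\<bar>x $ i\<bar> / a) powr p + t * (\<bar>y $ i\<bar> / b) powr p)"
      using ab st p by (intro mult_left_mono powr_convex_nonneg) auto
    finally show ?thesis
      using ab by (simp add: powr_divide)
  qed
  then have "lp_norm p (x + y) powr p
      \<le> (\<Sum>i\<in>UNIV. (a + b) powr p * (s * (\<bar>x $ i\<bar> powr p / a powr p) + t * (\<bar>y $ i\<bar> powr p / b powr p)))"
    unfolding lp_norm_powr by (intro sum_mono)
  also have "\<dots> = (a + b) powr p * (s * (lp_norm p x powr p / a powr p) + t * (lp_norm p y powr p / b powr p))"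
    unfolding lp_norm_powr
    by (simp only: sum_distrib_left[symmetric] sum.distrib sum_divide_distrib[symmetric])
  also have "\<dots> = (a + b) powr p"
    using ab st False by (simp add: a_def b_def)
  finally show ?thesis
    using p by (smt (verit) ab a_def b_def powr_less_mono2)
qed auto

lemma abs_lp_norm_diff_le: "\<bar>lp_norm p x - lp_norm p y\<bar> \<le> lp_norm p (x - y)"
  using lp_norm_triangle[of "x - y" y] lp_norm_triangle[of "y - x" x]
  by (simp add: lp_norm_minus_commute)

lemma continuous_on_lp_norm [continuous_intros]:
  assumes "continuous_on A f"
  shows "continuous_on A (\<lambda>x. lp_norm p (f x))"
  unfolding lp_norm_def using assms p
  by (intro continuous_on_powr' continuous_intros) (auto intro!: sum_nonneg)

lemma compact_lp_sphere: "compact (lp_sphere p :: (real^'n) set)"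
proof -
  have "closed (lp_sphere p :: (real^'n) set)"
    unfolding lp_sphere_def by (intro closed_Collect_eq continuous_intros)
  moreover have "bounded (lp_sphere p :: (real^'n) set)"
  proof -
    have "norm x \<le> (\<Sum>i\<in>(UNIV :: 'n set). 1)" if "x \<in> lp_sphere p" for x :: "real^'n"
      using that component_le_lp_norm[of x]
      by (intro order.trans[OF norm_le_l1_cart] sum_mono) (simp add: lp_sphere_def)
    then show ?thesis
      unfolding bounded_iff by blast
  qed
  ultimately show ?thesis
    by (simp add: compact_eq_bounded_closed)
qed

text \<open>Moving the vector and changing the normalising factor each cost at most
  \<open>lp_norm p (u - v) / a\<close>, whence the factor 2. This controls the length of a chord
  projected radially to the sphere.\<close>

lemma lp_norm_normalize_diff_le:
  assumes "0 < m" "m \<le> lp_norm p u" "m \<le> lp_norm p v"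
  shows "lp_norm p (u /\<^sub>R lp_norm p u - v /\<^sub>R lp_norm p v) \<le> 2 / m * lp_norm p (u - v)"
proof -
  define a b where "a = lp_norm p u" and "b = lp_norm p v"
  have ab: "0 < a" "0 < b" "m \<le> a"
    using assms by (auto simp: a_def b_def)
  have eq: "u /\<^sub>R a - v /\<^sub>R b = (1 / a) *\<^sub>R (u - v) + (1 / a - 1 / b) *\<^sub>R v"
    by (simp add: algebra_simps inverse_eq_divide)
  have "lp_norm p (u /\<^sub>R a - v /\<^sub>R b) \<le> lp_norm p (u - v) / a + \<bar>1 / a - 1 / b\<bar> * b"
    unfolding eq using ab by (intro order.trans[OF lp_norm_triangle]) (simp add: lp_norm_scaleR b_def)
  also have "\<bar>1 / a - 1 / b\<bar> * b = \<bar>a - b\<bar> / a"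
  proof -
    have "1 / a - 1 / b = (b - a) / (a * b)"
      using ab by (simp add: field_simps)
    then show ?thesis
      using ab by (simp add: abs_mult abs_minus_commute)
  qed
  also have "\<dots> \<le> lp_norm p (u - v) / a"
    using abs_lp_norm_diff_le[of u v] ab by (simp add: a_def b_def divide_right_mono)
  also have "lp_norm p (u - v) / a + lp_norm p (u - v) / a \<le> 2 / m * lp_norm p (u - v)"
    using ab assms(1) frac_le[of "2 * lp_norm p (u - v)" "2 * lp_norm p (u - v)" m a] by simp
  finally show ?thesis
    by (simp add: a_def b_def)
qed

section \<open>Lengths of curves\<close>

lemma lp_length_leI:
  assumes "\<And>n t. mono_on {..n} t \<Longrightarrow> t 0 = 0 \<Longrightarrow> t n = 1 \<Longrightarrow>
      ereal (\<Sum>i<n. lp_norm p (\<gamma> (t (Suc i)) - \<gamma> (t i))) \<le> L"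
  shows "lp_length p \<gamma> \<le> L"
  unfolding lp_length_def using assms by (intro SUP_least) auto

lemma sum_le_lp_length:
  assumes "mono_on {..n} t" "t 0 = 0" "t n = 1"
  shows "ereal (\<Sum>i<n. lp_norm p (\<gamma> (t (Suc i)) - \<gamma> (t i))) \<le> lp_length p \<gamma>"
  unfolding lp_length_def using assms by (intro SUP_upper2[of "(n, t)"]) auto

lemma subdivision_range:
  fixes t :: "nat \<Rightarrow> real"
  assumes "mono_on {..n} t" "t 0 = 0" "t n = 1" "i \<le> n"
  shows "t i \<in> {0..1}"
  using monotone_onD[OF assms(1), of 0 i] monotone_onD[OF assms(1), of i n] assms(2-) by auto

lemma lp_norm_endpoints_le_length: "ereal (lp_norm p (pathfinish \<gamma> - pathstart \<gamma>)) \<le> lp_length p \<gamma>"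
  \<comment> \<open>The trivial subdivision: \<open>n = 1\<close> and \<open>t = real\<close>, with
    the points 0 and 1.\<close>
  using sum_le_lp_length[of 1 real \<gamma>]
  by (simp add: pathfinish_def pathstart_def mono_on_def)

lemma lp_length_le_Lipschitz:
  assumes "\<And>s t. s \<in> {0..1} \<Longrightarrow> t \<in> {0..1} \<Longrightarrow> s \<le> t \<Longrightarrow> lp_norm p (\<gamma> t - \<gamma> s) \<le> L * (t - s)"
  shows "lp_length p \<gamma> \<le> ereal L"
proof (rule lp_length_leI)
  fix n and t :: "nat \<Rightarrow> real"
  assume t: "mono_on {..n} t" "t 0 = 0" "t n = 1"
  have "(\<Sum>i<n. lp_norm p (\<gamma> (t (Suc i)) - \<gamma> (t i))) \<le> (\<Sum>i<n. L * (t (Suc i) - t i))"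
    using subdivision_range[OF t] by (intro sum_mono assms) (auto intro: monotone_onD[OF t(1)])
  also have "\<dots> = L"
    using t by (simp add: sum_lessThan_telescope flip: sum_distrib_left)
  finally show "ereal (\<Sum>i<n. lp_norm p (\<gamma> (t (Suc i)) - \<gamma> (t i))) \<le> ereal L"
    by simp
qed

lemma lp_length_reversepath_le: "lp_length p (reversepath \<gamma>) \<le> lp_length p \<gamma>"
proof (rule lp_length_leI)
  fix n and t :: "nat \<Rightarrow> real"
  assume t: "mono_on {..n} t" "t 0 = 0" "t n = 1"
  \<comment> \<open>The subdivision read backwards; it is monotone because both reflections reverse
    the order.\<close>
  define s where "s i = 1 - t (n - i)" for i
  have "(\<Sum>i<n. lp_norm p (reversepath \<gamma> (t (Suc i)) - reversepath \<gamma> (t i)))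
      = (\<Sum>i<n. lp_norm p (reversepath \<gamma> (t (Suc (n - Suc i))) - reversepath \<gamma> (t (n - Suc i))))"
    by (rule sum.nat_diff_reindex[symmetric])
  also have "\<dots> = (\<Sum>i<n. lp_norm p (\<gamma> (s (Suc i)) - \<gamma> (s i)))"
    by (intro sum.cong refl) (simp add: s_def reversepath_def Suc_diff_Suc lp_norm_minus_commute)
  also have "ereal \<dots> \<le> lp_length p \<gamma>"
    using t by (intro sum_le_lp_length) (auto simp: s_def mono_on_def)
  finally show "ereal (\<Sum>i<n. lp_norm p (reversepath \<gamma> (t (Suc i)) - reversepath \<gamma> (t i))) \<le> lp_length p \<gamma>" .
qed

lemma lp_length_joinpaths_le:
  assumes "pathfinish \<gamma>1 = pathstart \<gamma>2"
  shows "lp_length p (\<gamma>1 +++ \<gamma>2) \<le> lp_length p \<gamma>1 + lp_length p \<gamma>2"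
proof (rule lp_length_leI)
  fix n and t :: "nat \<Rightarrow> real"
  assume t: "mono_on {..n} t" "t 0 = 0" "t n = 1"
  let ?\<gamma> = "\<gamma>1 +++ \<gamma>2"
  \<comment> \<open>Clamping distributes the subdivision over the two curves without inserting 1/2:
    \<open>l\<close> runs through the first half and then rests at 1, \<open>r\<close> rests at 0
    and then runs through the second half.\<close>
  define l r where "l i = min 1 (2 * t i)" and "r i = max 0 (2 * t i - 1)" for i
  \<comment> \<open>The curve that rests sits at the common point \<open>\<gamma>1 1\<close> and
    cancels against the last term.\<close>
  have split: "?\<gamma> (t i) = \<gamma>1 (l i) + \<gamma>2 (r i) - \<gamma>1 1" for i
  proof (cases "t i \<le> 1 / 2")
    case True
    then have "l i = 2 * t i" "r i = 0"
      by (auto simp: l_def r_def)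
    then show ?thesis
      using True assms by (simp add: joinpaths_def pathfinish_def pathstart_def)
  next
    case False
    then have "l i = 1" "r i = 2 * t i - 1"
      by (auto simp: l_def r_def)
    then show ?thesis
      using False assms by (simp add: joinpaths_def pathfinish_def pathstart_def)
  qed
  have "lp_norm p (?\<gamma> (t (Suc i)) - ?\<gamma> (t i))
      \<le> lp_norm p (\<gamma>1 (l (Suc i)) - \<gamma>1 (l i)) + lp_norm p (\<gamma>2 (r (Suc i)) - \<gamma>2 (r i))" for i
    unfolding split
    using lp_norm_triangle[of "\<gamma>1 (l (Suc i)) - \<gamma>1 (l i)" "\<gamma>2 (r (Suc i)) - \<gamma>2 (r i)"]
    by (simp add: algebra_simps)
  then have "ereal (\<Sum>i<n. lp_norm p (?\<gamma> (t (Suc i)) - ?\<gamma> (t i)))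
      \<le> ereal (\<Sum>i<n. lp_norm p (\<gamma>1 (l (Suc i)) - \<gamma>1 (l i))) + ereal (\<Sum>i<n. lp_norm p (\<gamma>2 (r (Suc i)) - \<gamma>2 (r i)))"
    by (simp add: sum_mono flip: sum.distrib)
  also have "\<dots> \<le> lp_length p \<gamma>1 + lp_length p \<gamma>2"
    using t by (intro add_mono sum_le_lp_length) (force simp: l_def r_def mono_on_def)+
  finally show "ereal (\<Sum>i<n. lp_norm p (?\<gamma> (t (Suc i)) - ?\<gamma> (t i))) \<le> lp_length p \<gamma>1 + lp_length p \<gamma>2" .
qed

end

subsection \<open>The geodesic metric\<close>

text \<open>The infimum in \<open>geo_dist\<close> before conversion to a real. It is \<infinity> if
  no curve joins the points, whereas \<open>real_of_ereal\<close> would then return 0; so the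
  triangle inequality is first proved in the extended reals.\<close>

definition geo_edist :: "real \<Rightarrow> real^'n \<Rightarrow> real^'n \<Rightarrow> ereal" where
  "geo_edist p x y = (INF \<gamma> \<in> {\<gamma>. path \<gamma> \<and> path_image \<gamma> \<subseteq> lp_sphere p \<and>
                                   pathstart \<gamma> = x \<and> pathfinish \<gamma> = y}. lp_length p \<gamma>)"

lemma geo_dist_altdef: "geo_dist p x y = real_of_ereal (geo_edist p x y)"
  by (simp add: geo_dist_def geo_edist_def)

lemma geo_edist_le_length:
  assumes "path \<gamma>" "path_image \<gamma> \<subseteq> lp_sphere p"
  shows "geo_edist p (pathstart \<gamma>) (pathfinish \<gamma>) \<le> lp_length p \<gamma>"
  unfolding geo_edist_def using assms by (intro INF_lower) auto

lemma le_geo_edistI: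
  assumes "\<And>\<gamma>. path \<gamma> \<Longrightarrow> path_image \<gamma> \<subseteq> lp_sphere p \<Longrightarrow> pathstart \<gamma> = x \<Longrightarrow> pathfinish \<gamma> = y
      \<Longrightarrow> L \<le> lp_length p \<gamma>"
  shows "L \<le> geo_edist p x y"
  unfolding geo_edist_def using assms by (intro INF_greatest) auto

context
  fixes p :: real
  assumes p: "1 \<le> p"
begin

lemma lp_norm_le_geo_edist: "ereal (lp_norm p (y - x)) \<le> geo_edist p x y"
  using lp_norm_endpoints_le_length[OF p] by (intro le_geo_edistI) auto

lemma geo_edist_nonneg: "0 \<le> geo_edist p x y"
  using lp_norm_le_geo_edist[of y x] lp_norm_nonneg[OF p, of "y - x"]
  by (metis ereal_less_eq(5) order.trans)

lemma geo_edist_commute: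
  fixes x y :: "real^'n"
  shows "geo_edist p x y = geo_edist p y x"
proof -
  have "geo_edist p x y \<le> geo_edist p y x" for x y :: "real^'n"
  proof (rule le_geo_edistI)
    fix \<gamma> :: "real \<Rightarrow> real^'n"
    assume \<gamma>: "path \<gamma>" "path_image \<gamma> \<subseteq> lp_sphere p" "pathstart \<gamma> = y" "pathfinish \<gamma> = x"
    then have "geo_edist p x y \<le> lp_length p (reversepath \<gamma>)"
      using geo_edist_le_length[of "reversepath \<gamma>" p] by simp
    also have "\<dots> \<le> lp_length p \<gamma>"
      by (rule lp_length_reversepath_le[OF p])
    finally show "geo_edist p x y \<le> lp_length p \<gamma>" .
  qed
  then show ?thesis
    by (simp add: antisym)
qed

lemma geo_edist_triangle: "geo_edist p x z \<le> geo_edist p x y + geo_edist p y z"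
proof -
  have join: "geo_edist p x z \<le> lp_length p \<gamma>1 + lp_length p \<gamma>2"
    if "path \<gamma>1" "path_image \<gamma>1 \<subseteq> lp_sphere p" "pathstart \<gamma>1 = x" "pathfinish \<gamma>1 = y"
      and "path \<gamma>2" "path_image \<gamma>2 \<subseteq> lp_sphere p" "pathstart \<gamma>2 = y" "pathfinish \<gamma>2 = z" for \<gamma>1 \<gamma>2
    using that geo_edist_le_length[of "\<gamma>1 +++ \<gamma>2" p] lp_length_joinpaths_le[OF p, of \<gamma>1 \<gamma>2]
      path_image_join_subset[of \<gamma>1 \<gamma>2] by (auto intro: order.trans)
  let ?P = "\<lambda>x y. {\<gamma>. path \<gamma> \<and> path_image \<gamma> \<subseteq> lp_sphere p \<and> pathstart \<gamma> = x \<and> pathfinish \<gamma> = (y :: real^'n)}"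
  have len: "0 \<le> lp_length p \<gamma>" for \<gamma> :: "real \<Rightarrow> real^'n"
    using lp_norm_endpoints_le_length[OF p, of \<gamma>] lp_norm_nonneg[OF p, of "pathfinish \<gamma> - pathstart \<gamma>"]
    by (metis ereal_less_eq(5) order.trans)
  show ?thesis
  proof (cases "?P x y = {} \<or> ?P y z = {}")
    case True
    then have "geo_edist p x y = \<infinity> \<or> geo_edist p y z = \<infinity>"
      unfolding geo_edist_def by (metis (no_types, lifting) INF_empty top_ereal_def)
    then show ?thesis
      using geo_edist_nonneg[of x y] geo_edist_nonneg[of y z] by auto
  next
    case False
    \<comment> \<open>The infimum over pairs of curves separates into a sum of two infima, one curve
      at a time; both families are nonempty and all lengths are nonnegative.\<close>
    have "geo_edist p x z \<le> (INF \<gamma>1 \<in> ?P x y. INF \<gamma>2 \<in> ?P y z. lp_length p \<gamma>2 + lp_length p \<gamma>1)"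
      using join by (intro INF_greatest) (auto simp: add.commute)
    also have "\<dots> = (INF \<gamma>1 \<in> ?P x y. geo_edist p y z + lp_length p \<gamma>1)"
      unfolding geo_edist_def using False len
      by (intro INF_cong refl INF_ereal_add_left) (auto simp: less_eq_ereal_def)
    also have "\<dots> = (INF \<gamma>1 \<in> ?P x y. lp_length p \<gamma>1 + geo_edist p y z)"
      by (simp add: add.commute)
    also have "\<dots> = geo_edist p x y + geo_edist p y z"
      unfolding geo_edist_def[of p x y] using False len geo_edist_nonneg[of y z]
      by (intro INF_ereal_add_left) auto
    finally show ?thesis .
  qed
qed

text \<open>The connecting curve is the chord projected radially to the sphere; \<open>m\<close>
  keeps the chord away from the origin, where this projection has Lipschitz constant 2/m.\<close>

lemma geo_edist_le_chord:
  assumes x: "x \<in> lp_sphere p" and y: "y \<in> lp_sphere p" and "0 < m"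
    and m: "\<And>t. t \<in> {0..1} \<Longrightarrow> m \<le> lp_norm p (linepath x y t)"
  shows "geo_edist p x y \<le> ereal (2 / m * lp_norm p (y - x))"
proof -
  define \<gamma> where "\<gamma> t = linepath x y t /\<^sub>R lp_norm p (linepath x y t)" for t
  have pos: "lp_norm p (linepath x y t) \<noteq> 0" if "t \<in> {0..1}" for t
    using m[OF that] \<open>0 < m\<close> by linarith
  have "path \<gamma>"
    unfolding path_def \<gamma>_def using pos
    by (intro continuous_intros continuous_on_lp_norm[OF p] ballI) auto
  moreover have "path_image \<gamma> \<subseteq> lp_sphere p"
    using pos p by (auto simp: path_image_def \<gamma>_def lp_sphere_def lp_norm_scaleR)
  ultimately have "geo_edist p (pathstart \<gamma>) (pathfinish \<gamma>) \<le> lp_length p \<gamma>"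
    by (rule geo_edist_le_length)
  moreover have "pathstart \<gamma> = x" "pathfinish \<gamma> = y"
    using x y by (simp_all add: pathstart_def pathfinish_def \<gamma>_def linepath_def lp_sphere_def)
  moreover have "lp_length p \<gamma> \<le> ereal (2 / m * lp_norm p (y - x))"
  proof (rule lp_length_le_Lipschitz[OF p])
    fix s t :: real
    assume st: "s \<in> {0..1}" "t \<in> {0..1}" "s \<le> t"
    have "linepath x y t - linepath x y s = (t - s) *\<^sub>R (y - x)"
      by (simp add: linepath_def algebra_simps)
    then show "lp_norm p (\<gamma> t - \<gamma> s) \<le> 2 / m * lp_norm p (y - x) * (t - s)"
      using lp_norm_normalize_diff_le[OF p \<open>0 < m\<close> m[OF st(2)] m[OF st(1)]] st
      by (simp add: \<gamma>_def lp_norm_scaleR[OF p] mult_ac)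
  qed
  ultimately show ?thesis
    by simp
qed

text \<open>If the chord met the origin, comparison of norms would make it the midpoint and the
  endpoints antipodal. Otherwise the norm has a positive minimum on the chord, which serves as
  \<open>m\<close>.\<close>

lemma geo_edist_finite_not_antipodal:
  assumes x: "x \<in> lp_sphere p" and y: "y \<in> lp_sphere p" and "y \<noteq> - x"
  shows "geo_edist p x y < \<infinity>"
proof -
  have nz: "linepath x y t \<noteq> 0" if "t \<in> {0..1}" for t
  proof
    assume "linepath x y t = 0"
    then have eq: "(1 - t) *\<^sub>R x = - (t *\<^sub>R y)"
      by (simp add: linepath_def eq_neg_iff_add_eq_0)
    then have "lp_norm p ((1 - t) *\<^sub>R x) = lp_norm p (t *\<^sub>R y)"
      using p by simp
    then have "1 - t = t"
      using x y that by (simp add: lp_norm_scaleR[OF p] lp_sphere_def)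
    with eq have "t *\<^sub>R y = t *\<^sub>R (- x)" "t \<noteq> 0"
      by auto
    then show False
      using \<open>y \<noteq> - x\<close> by (metis scaleR_left_imp_eq)
  qed
  obtain t0 where t0: "t0 \<in> {0..1}" "\<And>t. t \<in> {0..1} \<Longrightarrow> lp_norm p (linepath x y t0) \<le> lp_norm p (linepath x y t)"
    using continuous_attains_inf[OF _ _ continuous_on_lp_norm[OF p continuous_on_linepath], of "{0..1}" x y]
    by auto
  have "0 < lp_norm p (linepath x y t0)"
    using nz[OF t0(1)] p by (simp add: less_le)
  from geo_edist_le_chord[OF x y this t0(2)] show ?thesis
    by (metis PInfty_neq_ereal(1) ereal_infty_less(1) less_ereal.simps(2) order.strict_trans1)
qed

lemma axis_in_lp_sphere: "(axis i 1 :: real^'n) \<in> lp_sphere p"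
proof -
  have "\<bar>(axis i 1 :: real^'n) $ j\<bar> powr p = (if j = i then 1 else 0)" for j :: 'n
    by (simp add: axis_def)
  then show ?thesis
    by (simp add: lp_sphere_def lp_norm_def)
qed

text \<open>Antipodal points are joined via a third point. Here dimension at least 2 enters: of two
  distinct coordinate vectors, one differs from both \<open>x\<close> and
  \<open>- x\<close>.\<close>

lemma geo_edist_finite:
  fixes x y :: "real^'n"
  assumes dim: "2 \<le> CARD('n)" and x: "x \<in> lp_sphere p" and y: "y \<in> lp_sphere p"
  shows "geo_edist p x y < \<infinity>"
proof (cases "y = - x")
  case True
  have "\<exists>i j :: 'n. i \<noteq> j"
  proof (rule ccontr)
    assume "\<nexists>i j :: 'n. i \<noteq> j"
    then have "CARD('n) \<le> Suc 0"
      by (intro card_le_Suc0_iff_eq[THEN iffD2]) auto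
    with dim show False
      by simp
  qed
  then obtain i j :: 'n where "i \<noteq> j"
    by blast
  have "\<exists>z \<in> lp_sphere p. z \<noteq> x \<and> z \<noteq> - x"
  proof (cases "axis i 1 = x \<or> axis i 1 = - x")
    case True
    then have "x $ j = 0" "(axis j 1 :: real^'n) $ j = 1"
      using \<open>i \<noteq> j\<close> by (auto simp: axis_def vec_eq_iff split: if_splits)
    then have "axis j 1 \<noteq> x" "axis j 1 \<noteq> - x"
      by (metis zero_neq_one) (metis \<open>x $ j = 0\<close> \<open>axis j 1 $ j = 1\<close> neg_equal_0_iff_equal vector_uminus_component zero_neq_one)
    then show ?thesis
      using axis_in_lp_sphere by blast
  qed (use axis_in_lp_sphere in blast)
  then obtain z where z: "z \<in> lp_sphere p" "z \<noteq> x" "z \<noteq> - x"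
    by blast
  have "geo_edist p x y \<le> geo_edist p x z + geo_edist p z y"
    by (rule geo_edist_triangle)
  also have "\<dots> < \<infinity>"
    using geo_edist_finite_not_antipodal[OF x z(1)] geo_edist_finite_not_antipodal[OF z(1) y] z True
    by simp
  finally show ?thesis .
qed (rule geo_edist_finite_not_antipodal[OF x y])

lemma Metric_space_geo_dist:
  assumes dim: "2 \<le> CARD('n)"
  shows "Metric_space (lp_sphere p :: (real^'n) set) (geo_dist p)"
proof
  fix x y z :: "real^'n"
  show "0 \<le> geo_dist p x y"
    unfolding geo_dist_altdef by (intro real_of_ereal_pos geo_edist_nonneg)
  show "geo_dist p x y = geo_dist p y x"
    unfolding geo_dist_altdef by (simp add: geo_edist_commute)
  \<comment> \<open>On the sphere the distance is finite, so conversion to a real loses nothing and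
    the axioms carry over.\<close>
  have fin: "ereal (geo_dist p u v) = geo_edist p u v" if "u \<in> lp_sphere p" "v \<in> lp_sphere p" for u v :: "real^'n"
    using geo_edist_finite[OF dim that] geo_edist_nonneg[of u v]
    unfolding geo_dist_altdef by (intro ereal_real') auto
  show "geo_dist p x y = 0 \<longleftrightarrow> x = y" if xy: "x \<in> lp_sphere p" "y \<in> lp_sphere p"
  proof
    assume "geo_dist p x y = 0"
    then have "lp_norm p (y - x) \<le> 0"
      using lp_norm_le_geo_edist[of y x] fin[OF xy] by (metis ereal_less_eq(3))
    then show "x = y"
      using lp_norm_eq_0_iff[OF p, of "y - x"] lp_norm_nonneg[OF p, of "y - x"] by simp
  next
    assume "x = y"
    \<comment> \<open>The constant chord has norm 1 throughout, hence \<open>m = 1\<close>.\<close>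
    then have "geo_edist p x y \<le> ereal (2 / 1 * lp_norm p (y - x))"
      using xy by (intro geo_edist_le_chord) (auto simp: lp_sphere_def linepath_refl)
    then show "geo_dist p x y = 0"
      using \<open>x = y\<close> fin[OF xy] \<open>0 \<le> geo_dist p x y\<close> lp_norm_eq_0_iff[OF p, of "0 :: real^'n"]
      by (metis diff_self ereal_less_eq(3) mult_zero_right order.antisym)
  qed
  show "geo_dist p x z \<le> geo_dist p x y + geo_dist p y z"
    if "x \<in> lp_sphere p" "y \<in> lp_sphere p" "z \<in> lp_sphere p"
    using geo_edist_triangle[of x z y] that by (simp flip: fin)
qed

text \<open>A short chord from \<open>x\<close> stays off the origin, so its projection is short
  too. Consequently the geodesic topology is no finer than the Euclidean one on the sphere.\<close>

lemma geo_dist_small: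
  fixes x :: "real^'n"
  assumes x: "x \<in> lp_sphere p" and "0 < \<epsilon>"
  shows "\<exists>\<delta>>0. \<forall>y \<in> lp_sphere p. dist y x < \<delta> \<longrightarrow> geo_dist p x y < \<epsilon>"
proof -
  have "continuous_on UNIV (\<lambda>y. lp_norm p (y - x))"
    by (intro continuous_on_lp_norm[OF p] continuous_intros)
  \<comment> \<open>The bound 1/2 keeps the chord at norm at least 1/2, so the distance is at most 4
    times the chord; the bound \<epsilon>/5 then leaves less than \<epsilon>.\<close>
  moreover have "0 < min (1 / 2) (\<epsilon> / 5)"
    using \<open>0 < \<epsilon>\<close> by simp
  ultimately obtain \<delta> where "0 < \<delta>" and \<delta>: "\<And>y. dist y x < \<delta> \<Longrightarrow> lp_norm p (y - x) < min (1 / 2) (\<epsilon> / 5)"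
    unfolding continuous_on_iff using lp_norm_eq_0_iff[OF p, of "0 :: real^'n"] lp_norm_nonneg[OF p]
    by (metis UNIV_I abs_of_nonneg diff_self dist_0_norm dist_commute real_norm_def)
  have "geo_dist p x y < \<epsilon>" if y: "y \<in> lp_sphere p" "dist y x < \<delta>" for y
  proof -
    have "1 / 2 \<le> lp_norm p (linepath x y t)" if "t \<in> {0..1}" for t
    proof -
      have "lp_norm p x - lp_norm p (linepath x y t) \<le> lp_norm p (x - linepath x y t)"
        using abs_lp_norm_diff_le[OF p, of x "linepath x y t"] by simp
      also have "x - linepath x y t = (- t) *\<^sub>R (y - x)"
        by (simp add: linepath_def algebra_simps)
      also have "lp_norm p \<dots> \<le> 1 * (1 / 2)"
        unfolding lp_norm_scaleR[OF p] using that \<delta>[OF y(2)] lp_norm_nonneg[OF p]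
        by (intro mult_mono) auto
      finally show ?thesis
        using x by (simp add: lp_sphere_def)
    qed
    then have "geo_edist p x y \<le> ereal (4 * lp_norm p (y - x))"
      using geo_edist_le_chord[OF x y(1), of "1 / 2"] by simp
    then have "geo_dist p x y \<le> 4 * lp_norm p (y - x)"
      unfolding geo_dist_altdef real_le_ereal_iff
      using lp_norm_nonneg[OF p, of "y - x"] by simp
    then show ?thesis
      using \<delta>[OF y(2)] lp_norm_nonneg[OF p, of "y - x"] by linarith
  qed
  then show ?thesis
    using \<open>0 < \<delta>\<close> by blast
qed

end

subsection \<open>Testing sets and supports\<close>

text \<open>A local maximum is a maximum over the trace of some basic open set, and that set
  determines the value; a countable basis leaves countably many values.\<close>

lemma countable_local_max_values:
  fixes f :: "'a::second_countable_topology \<Rightarrow> real"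
  shows "countable {f y |y. y \<in> S \<and> (\<exists>U. open U \<and> y \<in> U \<and> (\<forall>z \<in> S \<inter> U. f z \<le> f y))}"
proof -
  obtain B :: "'a set set" where B: "countable B" "topological_basis B"
    using ex_countable_basis by blast
  \<comment> \<open>The maximum of \<open>f\<close> on \<open>S \<inter> b\<close> if it is
    attained, and arbitrary otherwise.\<close>
  define h where "h b = (SOME r. \<exists>y \<in> S \<inter> b. f y = r \<and> (\<forall>z \<in> S \<inter> b. f z \<le> f y))" for b
  have "f y \<in> h ` B" if y: "y \<in> S" and U: "open U" "y \<in> U" "\<forall>z \<in> S \<inter> U. f z \<le> f y" for y U
  proof -
    obtain b where b: "b \<in> B" "y \<in> b" "b \<subseteq> U"
      using topological_basisE[OF B(2) U(1,2)] by blast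
    have "\<exists>y' \<in> S \<inter> b. f y' = h b \<and> (\<forall>z \<in> S \<inter> b. f z \<le> f y')"
      unfolding h_def by (rule someI[of _ "f y"]) (use y U b in blast)
    then have "h b = f y"
      using y U b by (metis IntI Int_iff antisym subsetD)
    then show ?thesis
      using b(1) by (metis imageI)
  qed
  then have "{f y |y. y \<in> S \<and> (\<exists>U. open U \<and> y \<in> U \<and> (\<forall>z \<in> S \<inter> U. f z \<le> f y))} \<subseteq> h ` B"
    by blast
  then show ?thesis
    by (rule countable_subset) (rule countable_image[OF B(1)])
qed

text \<open>The parameter \<open>dimension\<close> only ties the type \<open>'n\<close> to the
  locale, so that its cardinality can be assumed to be at least 2.\<close>

locale lp_sphere_geometry =
  fixes p :: real and dimension :: "'n::finite itself"
  assumes p: "1 \<le> p" and dim: "2 \<le> CARD('n)"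
begin

section \<open>The geodesic topology, compactness and Borel sets\<close>

abbreviation sphere :: "(real^'n) set" where "sphere \<equiv> lp_sphere p"

sublocale geo: Metric_space sphere "geo_dist p"
  by (rule Metric_space_geo_dist[OF p dim])

lemma in_geo_ball [simp]: "y \<in> geo_ball p x r \<longleftrightarrow> x \<in> sphere \<and> y \<in> sphere \<and> geo_dist p x y < r"
  by (simp add: geo_ball_def)

lemma geo_ball_subset_sphere: "geo_ball p x r \<subseteq> sphere"
  by auto

lemma openin_geo_ball: "openin (geo_top p) (geo_ball p x r)" for x :: "real^'n"
  by (simp add: geo_top_def geo_ball_def)

lemma openin_geo_top_iff:
  "openin (geo_top p) U \<longleftrightarrow> U \<subseteq> sphere \<and> (\<forall>x\<in>U. \<exists>r>0. geo_ball p x r \<subseteq> U)"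
  by (auto simp: geo_top_def geo_ball_def geo.openin_mtopology)

lemma topspace_geo_top [simp]: "topspace (geo_top p) = sphere"
  by (simp add: geo_top_def)

text \<open>By \<open>geo_dist_small\<close>, a geodesic ball contains a Euclidean neighbourhood of
  its centre in the sphere. Through this inclusion compactness and measurability are inherited from
  the Euclidean topology.\<close>

lemma openin_geo_top_euclidean:
  assumes "openin (geo_top p) U"
  shows "openin (top_of_set sphere) U"
  unfolding openin_euclidean_subtopology_iff
proof (intro conjI ballI)
  show "U \<subseteq> sphere"
    using assms by (simp add: openin_geo_top_iff)
  fix x
  assume "x \<in> U"
  then obtain r where "0 < r" "geo_ball p x r \<subseteq> U" "x \<in> sphere"
    using assms unfolding openin_geo_top_iff by blast
  then show "\<exists>e>0. \<forall>x'\<in>sphere. dist x' x < e \<longrightarrow> x' \<in> U"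
    using geo_dist_small[OF p \<open>x \<in> sphere\<close> \<open>0 < r\<close>] by (auto simp: subset_iff)
qed

lemma geo_ballE:
  fixes x :: "real^'n"
  obtains T where "open T" "geo_ball p x r = sphere \<inter> T"
  using openin_geo_top_euclidean[OF openin_geo_ball, of x r] openin_open by metis

lemma closedin_geo_top_compact:
  fixes K :: "(real^'n) set"
  assumes "closedin (geo_top p) K"
  shows "compact K"
proof -
  have "closedin (top_of_set sphere) K"
    using assms openin_geo_top_euclidean by (auto simp: closedin_def)
  then show ?thesis
    using closedin_compact compact_lp_sphere[OF p] by blast
qed

text \<open>Geodesic balls are traces of Euclidean open sets, and \<open>K\<close> is compact in the
  Euclidean sense.\<close>

lemma geo_compact_cover:
  fixes K :: "(real^'n) set"
  assumes "closedin (geo_top p) K" "\<And>x. x \<in> K \<Longrightarrow> 0 < r x"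
  obtains C where "finite C" "C \<subseteq> K" "K \<subseteq> (\<Union>c\<in>C. geo_ball p c (r c))"
proof -
  have K: "K \<subseteq> sphere"
    using assms(1) closedin_subset by fastforce
  have "\<exists>T. open T \<and> geo_ball p x (r x) = sphere \<inter> T" for x
    by (rule geo_ballE) blast
  then obtain T where T: "\<And>x. open (T x)" "\<And>x. geo_ball p x (r x) = sphere \<inter> T x"
    by metis
  have "K \<subseteq> (\<Union>x\<in>K. T x)"
  proof
    fix x
    assume "x \<in> K"
    then have "x \<in> geo_ball p x (r x)"
      using K assms(2) by auto
    then show "x \<in> (\<Union>x\<in>K. T x)"
      using T(2) \<open>x \<in> K\<close> by blast
  qed
  then obtain C where "C \<subseteq> K" "finite C" "K \<subseteq> (\<Union>x\<in>C. T x)"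
    using compactE_image[OF closedin_geo_top_compact[OF assms(1)], of K T] T(1) by metis
  then show thesis
    using that[of C] K T(2) by blast
qed

lemma openin_geo_borel: "openin (geo_top p) U \<Longrightarrow> U \<in> geo_borel p" for U :: "(real^'n) set"
  unfolding geo_borel_def by (rule sigma_sets.Basic) simp

lemma geo_borel_Compl: "A \<in> geo_borel p \<Longrightarrow> sphere - A \<in> geo_borel p"
  unfolding geo_borel_def by (rule sigma_sets.Compl)

lemma closedin_geo_borel: "closedin (geo_top p) K \<Longrightarrow> K \<in> geo_borel p" for K :: "(real^'n) set"
  using geo_borel_Compl[OF openin_geo_borel, of "sphere - K"]
  by (auto simp: closedin_def double_diff)

text \<open>The generators are Euclidean open in the sphere, which is itself Borel. Hence a law on
  the Borel sets of Euclidean space measures every geodesic Borel set.\<close>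

lemma geo_borel_subset_borel: "geo_borel p \<subseteq> sets (borel :: (real^'n) measure)"
proof -
  have sphere: "sphere \<in> sets borel"
    using compact_lp_sphere[OF p] by (rule borel_compact)
  have "{V :: (real^'n) set. openin (geo_top p) V} \<subseteq> sets (restrict_space borel sphere)"
  proof
    fix V :: "(real^'n) set"
    assume "V \<in> {V. openin (geo_top p) V}"
    then have "openin (top_of_set sphere) V"
      using openin_geo_top_euclidean by simp
    then obtain T where "open T" "V = sphere \<inter> T"
      unfolding openin_open by metis
    then show "V \<in> sets (restrict_space borel sphere)"
      unfolding sets_restrict_space by (intro image_eqI[of _ _ T]) simp_all
  qed
  from sets.sigma_sets_subset[OF this]
  have "geo_borel p \<subseteq> sets (restrict_space borel sphere)"
    by (simp add: geo_borel_def space_restrict_space)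
  also have "\<dots> \<subseteq> sets borel"
    using sphere by (auto simp: sets_restrict_space)
  finally show ?thesis .
qed

section \<open>Testing sets\<close>

lemma testing_sets_openin: "A \<in> testing_sets p \<Longrightarrow> openin (geo_top p) A" for A :: "(real^'n) set"
  unfolding testing_sets_def by (auto intro!: openin_Union openin_geo_ball)

lemma testing_setsI:
  assumes C: "finite C" "C \<subseteq> sphere" "0 < r"
    and "\<And>x \<epsilon>. x \<in> sphere - (\<Union>c\<in>C. geo_ball p c r) \<Longrightarrow> 0 < \<epsilon> \<Longrightarrow>
      \<exists>y\<in>sphere. \<exists>s>0. geo_ball p y s \<subseteq> geo_ball p x \<epsilon> \<and> geo_ball p y s \<subseteq> sphere - (\<Union>c\<in>C. geo_ball p c r)"
  shows "(\<Union>c\<in>C. geo_ball p c r) \<in> testing_sets p"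
  unfolding testing_sets_def
proof (rule CollectI, rule conjI)
  show "\<exists>F. finite F \<and> (\<forall>(c, r)\<in>F. c \<in> sphere \<and> 0 < r) \<and>
      (\<Union>c\<in>C. geo_ball p c r) = (\<Union>(c, r)\<in>F. geo_ball p c r)"
    using C by (intro exI[of _ "(\<lambda>c. (c, r)) ` C"]) auto
qed (use assms(4) in simp)

text \<open>By compactness finitely many balls of radius 1 cover the sphere, and the condition on
  the complement is then void.\<close>

lemma sphere_testing_set: "sphere \<in> testing_sets p"
proof -
  have "closedin (geo_top p) sphere"
    by (metis closedin_topspace topspace_geo_top)
  then obtain C where C: "finite C" "C \<subseteq> sphere" "sphere \<subseteq> (\<Union>c\<in>C. geo_ball p c 1)"
    by (rule geo_compact_cover[of sphere "\<lambda>_. 1"]) auto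
  then have "(\<Union>c\<in>C. geo_ball p c 1) = sphere"
    using geo_ball_subset_sphere by blast
  then show ?thesis
    using testing_setsI[OF C(1,2), of 1] by simp
qed

text \<open>A point of the complement that is not a limit of interior points of the complement is a
  local maximum, with value \<open>r\<close>, of the distance to \<open>C\<close>; such values \<open>r\<close> are countably many.\<close>

lemma union_balls_testing_set:
  assumes C: "finite C" "C \<subseteq> sphere" and ab: "0 < a" "a < b"
  obtains r where "a < r" "r < b" "(\<Union>c\<in>C. geo_ball p c r) \<in> testing_sets p"
proof (cases "C = {}")
  \<comment> \<open>\<open>Min\<close> needs a nonempty set of centres; without centres the union is
    empty for every radius.\<close>
  case True
  have "(\<Union>c\<in>{} :: (real^'n) set. geo_ball p c 1) \<in> testing_sets p"
    by (rule testing_setsI) (use geo_ball_subset_sphere in auto)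
  then show thesis
    using that[of "(a + b) / 2"] ab True by simp
next
  case False
  define f where "f y = Min ((\<lambda>c. geo_dist p c y) ` C)" for y
  have f_ge: "r \<le> f y \<longleftrightarrow> (\<forall>c\<in>C. r \<le> geo_dist p c y)"
    for r y
    using C(1) False by (simp add: f_def)
  let ?V = "{f y |y. y \<in> sphere \<and> (\<exists>U. open U \<and> y \<in> U \<and> (\<forall>z \<in> sphere \<inter> U. f z \<le> f y))}"
  have "\<not> {a<..<b} \<subseteq> ?V"
    using countable_subset[OF _ countable_local_max_values, of "{a<..<b}"] uncountable_open_interval[of a b] ab(2) by blast
  then obtain r where "r \<in> {a<..<b}" and r_notin: "r \<notin> ?V"
    by blast
  then have r: "a < r" "r < b"
    by simp_all
  let ?A = "\<Union>c\<in>C. geo_ball p c r"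
  have "\<exists>y\<in>sphere. \<exists>s>0. geo_ball p y s \<subseteq> geo_ball p x e \<and> geo_ball p y s \<subseteq> sphere - ?A"
    if x: "x \<in> sphere - ?A" and "0 < e" for x e
  proof -
    have fx: "r \<le> f x"
      unfolding f_ge using x C(2) by (auto simp: not_less subset_iff)
    \<comment> \<open>A point near \<open>x\<close> where \<open>f\<close> strictly exceeds
      \<open>r\<close>: if \<open>f x = r\<close>, the choice of \<open>r\<close> prevents
      \<open>x\<close> from being a local maximum; otherwise \<open>x\<close> itself will
      do.\<close>
    obtain z where z: "z \<in> geo_ball p x e" "r < f z"
    proof (cases "f x = r")
      case True
      obtain T where T: "open T" "geo_ball p x e = sphere \<inter> T"
        by (rule geo_ballE)
      moreover have "x \<in> T"
        using x \<open>0 < e\<close> T(2) by (metis DiffD1 IntD2 geo.mdist_zero in_geo_ball)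
      ultimately have "\<not> (\<forall>z \<in> sphere \<inter> T. f z \<le> f x)"
        using r_notin True x by blast
      then show thesis
        using that T(2) True by (auto simp: not_le)
    next
      case False
      then show thesis
        using that[of x] x \<open>0 < e\<close> fx by auto
    qed
    \<comment> \<open>The first term keeps the ball around \<open>z\<close> inside the ball around
      \<open>x\<close>; the second keeps \<open>f\<close> at least \<open>r\<close> on it, since
      distances to the centres change at most by the distance moved.\<close>
    define s where "s = min (e - geo_dist p x z) (f z - r)"
    have "0 < s"
      using z by (simp add: s_def)
    moreover have "geo_ball p z s \<subseteq> geo_ball p x e"
    proof
      fix y
      assume "y \<in> geo_ball p z s"
      then show "y \<in> geo_ball p x e"
        using z geo.triangle[of x z y] by (simp add: s_def)
    qed
    moreover have "geo_ball p z s \<subseteq> sphere - ?A"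
    proof
      fix y
      assume y: "y \<in> geo_ball p z s"
      have "r \<le> geo_dist p c y" if "c \<in> C" for c
      proof -
        have "f z \<le> geo_dist p c z"
          using f_ge[of "f z" z] that by simp
        also have "\<dots> \<le> geo_dist p c y + geo_dist p z y"
          using geo.triangle'[of c y z] y that C(2) by auto
        finally show ?thesis
          using y by (simp add: s_def)
      qed
      then show "y \<in> sphere - ?A"
        using y by (auto simp: not_less)
    qed
    ultimately show ?thesis
      using z(1) by (intro bexI[of _ z] exI[of _ s]) auto
  qed
  then have "?A \<in> testing_sets p"
    using C ab(1) r(1) by (intro testing_setsI) auto
  then show thesis
    using that r(1,2) by blast
qed

lemma t1_space_geo_top: "t1_space (geo_top p :: (real^'n) topology)"
  unfolding geo_top_def by (rule Hausdorff_imp_t1_space[OF geo.Hausdorff_space_mtopology])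

lemma openin_geo_enlarge:
  assumes "A \<subseteq> sphere"
  shows "openin (geo_top p) (geo_enlarge p \<delta> A)"
proof -
  have "geo_enlarge p \<delta> A = (\<Union>a\<in>A. geo_ball p a \<delta>)"
    using assms geo.commute by (fastforce simp: geo_enlarge_def INF_less_iff)
  then show ?thesis
    by (auto intro: openin_geo_ball)
qed

text \<open>A closure point has points of \<open>A\<close> at arbitrarily small distance, in
  particular below \<open>\<delta>\<close>.\<close>

lemma closure_subset_geo_enlarge:
  fixes A :: "(real^'n) set"
  assumes "0 < \<delta>"
  shows "geo_top p closure_of A \<subseteq> geo_enlarge p \<delta> A"
  unfolding geo_top_def geo.metric_closure_of geo_enlarge_def using assms
  by (auto simp: INF_less_iff)

section \<open>Supports of finite measures on the sphere\<close>

definition supp :: "(real^'n) measure \<Rightarrow> (real^'n) set" where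
  "supp N = {x \<in> sphere. \<forall>\<epsilon>>0. 0 < measure N (geo_ball p x \<epsilon>)}"

text \<open>The form that \<open>S_tilde\<close> takes once the comparison of the two limits of
  \<open>g\<close> is known to mean that the complement is null.\<close>

definition tested_core :: "(real^'n) measure \<Rightarrow> (real^'n) set" where
  "tested_core N = \<Inter>{A \<in> testing_sets p. measure N (sphere - A) = 0}"

context
  fixes N :: "(real^'n) measure"
  assumes fin: "finite_measure N" and sets_N: "sets N = sets borel"
begin

interpretation N: finite_measure N
  by (rule fin)

lemma geo_borel_sets [intro]: "A \<in> geo_borel p \<Longrightarrow> A \<in> sets N"
  using geo_borel_subset_borel by (auto simp: sets_N)

text \<open>Each point of \<open>K\<close> has a null ball around it, and by compactness finitely
  many of these cover \<open>K\<close>.\<close>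

lemma measure_closed_disjoint_supp:
  assumes K: "closedin (geo_top p) K" and disj: "K \<inter> supp N = {}"
  shows "measure N K = 0"
proof -
  have sub: "K \<subseteq> sphere"
    using K closedin_subset by fastforce
  have "\<forall>x\<in>K. \<exists>r>0. measure N (geo_ball p x r) = 0"
  proof
    fix x
    assume "x \<in> K"
    then have "\<exists>r>0. \<not> 0 < measure N (geo_ball p x r)"
      using sub disj unfolding supp_def by blast
    then show "\<exists>r>0. measure N (geo_ball p x r) = 0"
      by (simp add: zero_less_measure_iff)
  qed
  then obtain r where r: "\<And>x. x \<in> K \<Longrightarrow> 0 < r x" "\<And>x. x \<in> K \<Longrightarrow> measure N (geo_ball p x (r x)) = 0"
    by metis
  obtain C where C: "finite C" "C \<subseteq> K" "K \<subseteq> (\<Union>c\<in>C. geo_ball p c (r c))"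
    by (rule geo_compact_cover[OF K r(1)])
  have sets: "geo_ball p x e \<in> sets N" for x e
    by (intro geo_borel_sets openin_geo_borel openin_geo_ball)
  have "measure N K \<le> measure N (\<Union>c\<in>C. geo_ball p c (r c))"
    using C sets by (intro N.finite_measure_mono) auto
  also have "\<dots> \<le> (\<Sum>c\<in>C. measure N (geo_ball p c (r c)))"
    using C(1) sets by (intro N.finite_measure_subadditive_finite) auto
  also have "\<dots> = 0"
    using r(2) C(2) by (intro sum.neutral) auto
  finally show ?thesis
    by (simp add: measure_le_0_iff)
qed

lemma closure_tested_core_eq_supp:
  assumes T1: "openin (geo_top p) T1" and T2: "finite T2" "T2 \<subseteq> sphere"
    and atoms: "\<And>x. x \<in> T2 \<Longrightarrow> 0 < measure N {x}"
    and supp: "supp N = (geo_top p closure_of T1) \<union> T2"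
  shows "geo_top p closure_of (tested_core N) = supp N"
proof
  have closed_T2: "closedin (geo_top p) T2"
    using T2 t1_space_closedin_finite[of "geo_top p :: (real^'n) topology"] t1_space_geo_top by simp
  then have closed: "closedin (geo_top p) (supp N)"
    unfolding supp by (intro closedin_Un) auto
  have "x \<in> supp N" if x: "x \<in> tested_core N" for x
  proof (rule ccontr)
    assume "x \<notin> supp N"
    show False
    proof (cases "x \<in> sphere")
      case True
      then obtain e where e: "0 < e" "geo_ball p x e \<subseteq> sphere - supp N"
        using closed \<open>x \<notin> supp N\<close> unfolding closedin_def openin_geo_top_iff
        by (metis DiffI topspace_geo_top)
      \<comment> \<open>Balls of radius e/4 around a net already cover the support, while balls of
        radius below e/2 around points of the support cannot reach \<open>x\<close>. The gap between
        the two leaves room to choose a radius that gives a testing set.\<close>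
      have "0 < e / 4" "e / 4 < e / 2"
        using e by auto
      obtain C where C: "finite C" "C \<subseteq> supp N" "supp N \<subseteq> (\<Union>c\<in>C. geo_ball p c (e / 4))"
        by (rule geo_compact_cover[OF closed, of "\<lambda>_. e / 4"]) (use \<open>0 < e / 4\<close> in auto)
      have "C \<subseteq> sphere"
        using C(2) by (auto simp: supp_def)
      obtain r where r: "e / 4 < r" "r < e / 2" and A: "(\<Union>c\<in>C. geo_ball p c r) \<in> testing_sets p"
        by (rule union_balls_testing_set[OF C(1) \<open>C \<subseteq> sphere\<close> \<open>0 < e / 4\<close> \<open>e / 4 < e / 2\<close>])
      have "supp N \<subseteq> (\<Union>c\<in>C. geo_ball p c r)"
        using C(3) r(1) by force
      moreover have "closedin (geo_top p) (sphere - (\<Union>c\<in>C. geo_ball p c r))"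
        using testing_sets_openin[OF A] by (metis closedin_diff closedin_topspace topspace_geo_top)
      ultimately have "measure N (sphere - (\<Union>c\<in>C. geo_ball p c r)) = 0"
        by (intro measure_closed_disjoint_supp) auto
      with A x have "x \<in> (\<Union>c\<in>C. geo_ball p c r)"
        unfolding tested_core_def by blast
      then obtain c where "c \<in> C" "geo_dist p c x < r"
        by auto
      then have "c \<in> geo_ball p x e"
        using True C(2) r(2) e(1) geo.commute[of c x] by (auto simp: supp_def)
      then show False
        using \<open>c \<in> C\<close> C(2) e(2) by blast
    next
      case False
      then show False
        using x sphere_testing_set unfolding tested_core_def by auto
    qed
  qed
  then show "geo_top p closure_of (tested_core N) \<subseteq> supp N"
    using closed by (simp add: closure_of_minimal subsetI)
  have core: "T1 \<union> T2 \<subseteq> A" if A: "A \<in> testing_sets p" "measure N (sphere - A) = 0" for A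
  proof (intro Un_least subsetI)
    have null: "measure N B = 0" if "B \<subseteq> sphere - A" for B
      using N.finite_measure_mono[OF that] A testing_sets_openin openin_geo_borel geo_borel_Compl
      by (metis geo_borel_sets measure_le_0_iff)
    fix x
    show "x \<in> A" if "x \<in> T2"
      using atoms[OF that] null[of "{x}"] T2 that by auto
    show "x \<in> A" if x: "x \<in> T1"
    proof (rule ccontr)
      assume "x \<notin> A"
      have T1': "T1 \<subseteq> sphere" "\<forall>x\<in>T1. \<exists>r>0. geo_ball p x r \<subseteq> T1"
        using T1 by (simp_all add: openin_geo_top_iff)
      then obtain e where e: "0 < e" "geo_ball p x e \<subseteq> T1"
        using x by metis
      have "x \<in> sphere - A"
        using T1'(1) x \<open>x \<notin> A\<close> by blast
      \<comment> \<open>The contradiction comes from the centre \<open>y\<close> of the smaller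
        ball, not from \<open>x\<close>: that ball is null, yet \<open>y\<close> lies in
        \<open>T1\<close> and so in the support.\<close>
      moreover have "\<forall>x \<in> sphere - A. \<forall>\<epsilon>>0. \<exists>y \<in> sphere. \<exists>r>0.
          geo_ball p y r \<subseteq> geo_ball p x \<epsilon> \<and> geo_ball p y r \<subseteq> sphere - A"
        using A(1) by (simp add: testing_sets_def)
      ultimately obtain y r where yr: "y \<in> sphere" "0 < r" "geo_ball p y r \<subseteq> geo_ball p x e" "geo_ball p y r \<subseteq> sphere - A"
        using e(1) by metis
      moreover have "y \<in> geo_ball p y r"
        using yr(1,2) by simp
      ultimately have "y \<in> T1"
        using e(2) by blast
      then have "y \<in> supp N"
        using supp closure_of_subset[OF openin_subset[OF T1]] by blast
      then show False
        using null[OF yr(4)] yr(2) by (auto simp: supp_def)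
    qed
  qed
  then have "T1 \<union> T2 \<subseteq> tested_core N"
    unfolding tested_core_def by blast
  then have "geo_top p closure_of (T1 \<union> T2) \<subseteq> geo_top p closure_of (tested_core N)"
    by (rule closure_of_mono)
  \<comment> \<open>A finite set is closed, so taking the closure adds nothing to
    \<open>T2\<close>.\<close>
  moreover have "geo_top p closure_of (T1 \<union> T2) = supp N"
    unfolding supp closure_of_Un using closed_T2 by (simp add: closure_of_closedin)
  ultimately show "supp N \<subseteq> geo_top p closure_of (tested_core N)"
    by metis
qed

end

end

subsection \<open>The limits of \<open>g\<close>\<close>

lemma (in prob_space) prob_greater_tendsto_0:
  fixes Y :: "'a \<Rightarrow> real"
  assumes Y: "Y \<in> borel_measurable M"
  shows "((\<lambda>k. \<P>(\<omega> in M. Y \<omega> > k)) \<longlongrightarrow> 0) at_top"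
proof -
  interpret D: real_distribution "distr M borel Y"
    by (rule real_distribution_distr[OF Y])
  have eq: "\<P>(\<omega> in M. Y \<omega> > k) = 1 - cdf (distr M borel Y) k" for k
  proof -
    have "\<P>(\<omega> in M. Y \<omega> \<le> k) = cdf (distr M borel Y) k"
      using Y by (simp add: cdf_def measure_distr vimage_def Int_def conj_commute)
    moreover have "{\<omega> \<in> space M. Y \<omega> \<le> k} \<in> events"
      using Y by measurable
    ultimately show ?thesis
      using prob_neg[of "\<lambda>\<omega>. Y \<omega> \<le> k"] by (simp add: not_le)
  qed
  show ?thesis
    unfolding eq using tendsto_diff[OF tendsto_const D.cdf_lim_at_top_prob, of 1] by simp
qed

text \<open>A constant factor only adds \<open>ln a / ln (T k)\<close> to the quotient, and this
  vanishes because \<open>ln (T k)\<close> tends to minus infinity.\<close>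

lemma elog_ratio_tendsto_1:
  fixes T :: "real \<Rightarrow> real"
  assumes "0 < a" and pos: "\<And>k. 0 < T k" and lim: "(T \<longlongrightarrow> 0) at_top"
  shows "((\<lambda>k. elog (a * T k) / elog (T k)) \<longlongrightarrow> 1) at_top"
proof -
  have "T k \<noteq> 0" for k
    using pos[of k] by simp
  then have "filterlim T (at_right 0) at_top"
    unfolding filterlim_at using pos lim by simp
  then have "filterlim (\<lambda>k. ln (T k)) at_bot at_top"
    by (rule filterlim_compose[OF ln_at_0])
  then have "((\<lambda>k. ln a / ln (T k)) \<longlongrightarrow> 0) at_top"
    by (intro tendsto_divide_0[OF tendsto_const] filterlim_at_bot_imp_at_infinity)
  then have "((\<lambda>k. ereal (ln a / ln (T k) + 1)) \<longlongrightarrow> ereal (0 + 1)) at_top"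
    by (intro tendsto_intros)
  moreover have "\<forall>\<^sub>F k in at_top. ereal (ln a / ln (T k) + 1) = elog (a * T k) / elog (T k)"
    using order_tendstoD(2)[OF lim zero_less_one]
  proof eventually_elim
    case (elim k)
    then have "ln (T k) < 0"
      using pos[of k] by simp
    then show ?case
      using pos[of k] \<open>0 < a\<close> by (simp add: elog_def ln_mult add_divide_distrib)
  qed
  ultimately show ?thesis
    unfolding one_ereal_def using Lim_transform_eventually by fastforce
qed

lemma elog_0_ratio:
  assumes "0 < c" "c < 1"
  shows "elog 0 / elog c = \<infinity>"
  using assms by (simp add: elog_def divide_ereal_def)

theorem theorem3p1:
  fixes M :: "'w measure" and X :: "'w \<Rightarrow> real^'n" and p :: real
  assumes "prob_space M" and "X \<in> borel_measurable M"
    and dim: "CARD('n) \<ge> 2" and p: "1 \<le> p"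
    and A1_pos: "AE \<omega> in M. radius p X \<omega> > 0"
    and A1_unbounded: "\<forall>k::real. \<P>(\<omega> in M. radius p X \<omega> > k) > 0"
    and A1_tail: "((\<lambda>k::real. - ln \<P>(\<omega> in M. radius p X \<omega> > k) / k) \<longlongrightarrow> 0) at_top"
    and A2: "\<exists>k0>0. \<forall>A \<in> geo_borel p. \<exists>c. \<forall>k>k0.
               \<P>(\<omega> in M. angle p X \<omega> \<in> A \<bar> radius p X \<omega> > k) = c"
    and A3: "\<forall>A \<in> geo_borel p. \<exists>L\<ge>0. ((\<lambda>k. g_quot M p X k A) \<longlongrightarrow> L) at_top"
    and A4_compl: "\<exists>V. openin (geo_top p) V \<and> V \<noteq> {} \<and> V \<subseteq> lp_sphere p - S_set M p X"
    and A4_form: "\<exists>T1 T2. openin (geo_top p) T1 \<and> finite T2 \<and> T2 \<subseteq> lp_sphere p \<and>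
               (\<forall>x\<in>T2. \<exists>m>0. ((\<lambda>k. \<P>(\<omega> in M. angle p X \<omega> \<in> {x} \<bar> radius p X \<omega> > k)) \<longlongrightarrow> m) at_top) \<and>
               S_set M p X = (geo_top p closure_of T1) \<union> T2"
  shows "S_set M p X = geo_top p closure_of (S_tilde M p X) \<and>
         (\<forall>\<delta>>0.
            ((\<lambda>k. g_quot M p X k (geo_enlarge p \<delta> (S_tilde M p X))) \<longlongrightarrow> 1) at_top \<and>
            (\<exists>L>1. ((\<lambda>k. g_quot M p X k (lp_sphere p - geo_enlarge p \<delta> (S_tilde M p X))) \<longlongrightarrow> L) at_top))"
proof -
  interpret prob_space M by fact
  interpret lp_sphere_geometry p "TYPE('n)"
    by unfold_locales (fact p, fact dim)
  have X [measurable]: "X \<in> borel_measurable M" by fact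
  have "lp_norm p \<in> borel_measurable (borel :: (real^'n) measure)"
    by (intro borel_measurable_continuous_onI continuous_on_lp_norm[OF p] continuous_intros)
  then have R [measurable]: "radius p X \<in> borel_measurable M"
    unfolding radius_def[abs_def] using X by simp
  have U [measurable]: "angle p X \<in> borel_measurable M"
    unfolding angle_def[abs_def] by measurable

  \<comment> \<open>The law of the angle beyond a threshold\<close>
  define T where "T k = \<P>(\<omega> in M. radius p X \<omega> > k)" for k
  have T_pos: "0 < T k" for k
    using A1_unbounded by (simp add: T_def)
  have T_lim: "(T \<longlongrightarrow> 0) at_top"
    unfolding T_def[abs_def] by (rule prob_greater_tendsto_0[OF R])
  obtain k0 where "0 < k0"
    and k0: "\<And>A. A \<in> geo_borel p \<Longrightarrow> \<exists>c. \<forall>k>k0. \<P>(\<omega> in M. angle p X \<omega> \<in> A \<bar> radius p X \<omega> > k) = c"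
    using A2 by blast
  \<comment> \<open>(A2) speaks of thresholds strictly above \<open>k0\<close>, hence the
    increment.\<close>
  define k1 where "k1 = k0 + 1"
  have k1: "k0 < k1" "0 < k1"
    using \<open>0 < k0\<close> by (simp_all add: k1_def)
  define E where "E = {\<omega> \<in> space M. radius p X \<omega> > k1}"
  \<comment> \<open>The law of the angle on the event \<open>R > k1\<close>, left unnormalised with
    total mass \<open>T k1\<close>; only positivity or vanishing of its values will matter.\<close>
  define N where "N = distr (restrict_space M E) borel (angle p X)"
  have E [measurable]: "E \<in> events"
    unfolding E_def by measurable
  have fin: "finite_measure N" and sets_N: "sets N = sets borel"
    unfolding N_def
    by (auto intro!: finite_measure.finite_measure_distr finite_measure_restrict_space measurable_restrict_space1
        simp: finite_measure_axioms)
  have borel: "A \<in> sets borel" if "A \<in> geo_borel p" for A :: "(real^'n) set"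
    using that geo_borel_subset_borel by blast
  have N_eq: "measure N A = \<P>(\<omega> in M. radius p X \<omega> > k1 \<and> angle p X \<omega> \<in> A)" if "A \<in> geo_borel p" for A
  proof -
    have "measure N A = measure (restrict_space M E) (angle p X -` A \<inter> E)"
      using borel[OF that] E sets.sets_into_space[OF E]
      by (simp add: N_def measure_distr measurable_restrict_space1 space_restrict_space Int_absorb2)
    also have "\<dots> = prob (angle p X -` A \<inter> E)"
      using E sets.sets_into_space[OF E] by (intro measure_restrict_space) auto
    also have "angle p X -` A \<inter> E = {\<omega> \<in> space M. radius p X \<omega> > k1 \<and> angle p X \<omega> \<in> A}"
      by (auto simp: E_def)
    finally show ?thesis .
  qed
  \<comment> \<open>By (A2) the conditional probability at \<open>k\<close> equals the one at
    \<open>k1\<close>, so the joint probability is a fixed multiple of \<open>T k\<close>.\<close>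
  have joint: "\<P>(\<omega> in M. radius p X \<omega> > k \<and> angle p X \<omega> \<in> A) = measure N A / T k1 * T k"
    and cond: "\<P>(\<omega> in M. angle p X \<omega> \<in> A \<bar> radius p X \<omega> > k) = measure N A / T k1"
    if A: "A \<in> geo_borel p" and "k0 < k" for A k
  proof -
    obtain c where c: "\<And>k. k0 < k \<Longrightarrow> \<P>(\<omega> in M. radius p X \<omega> > k \<and> angle p X \<omega> \<in> A) / T k = c"
      using k0[OF A] unfolding cond_prob_def T_def by (auto simp: conj_commute)
    from c[OF k1(1)] have "c = measure N A / T k1"
      by (simp add: N_eq[OF A])
    then show "\<P>(\<omega> in M. radius p X \<omega> > k \<and> angle p X \<omega> \<in> A) = measure N A / T k1 * T k"
      using c[OF \<open>k0 < k\<close>] T_pos[of k] by (simp add: field_simps)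
    show "\<P>(\<omega> in M. angle p X \<omega> \<in> A \<bar> radius p X \<omega> > k) = measure N A / T k1"
      using c[OF \<open>k0 < k\<close>] \<open>c = _\<close> unfolding cond_prob_def T_def by (simp add: conj_commute)
  qed
  have elog_joint: "\<forall>\<^sub>F k in at_top. \<P>(\<omega> in M. radius p X \<omega> > k \<and> angle p X \<omega> \<in> A) = measure N A / T k1 * T k"
    if "A \<in> geo_borel p" for A
    using eventually_gt_at_top[of k0] by eventually_elim (rule joint[OF that])
  \<comment> \<open>The divisor \<open>b\<close> serves two purposes: 1 gives \<open>g\<close>, and
    the probability of \<open>A\<close> under the angle gives the conditional quotient in the
    definition of \<open>S\<close>.\<close>
  have ratio_pos: "((\<lambda>k. elog (\<P>(\<omega> in M. radius p X \<omega> > k \<and> angle p X \<omega> \<in> A) / b) / elog (T k)) \<longlongrightarrow> 1) at_top"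
    if A: "A \<in> geo_borel p" and "0 < measure N A" "0 < b" for A b
  proof -
    have "((\<lambda>k. elog (measure N A / T k1 / b * T k) / elog (T k)) \<longlongrightarrow> 1) at_top"
      using that T_pos T_lim by (intro elog_ratio_tendsto_1) auto
    then show ?thesis
      by (rule Lim_transform_eventually) (use elog_joint[OF A] in \<open>eventually_elim, simp\<close>)
  qed
  \<comment> \<open>Here \<open>b\<close> may be 0 as well: the numerator is eventually 0, and 0/0
    is 0.\<close>
  have ratio_zero: "((\<lambda>k. elog (\<P>(\<omega> in M. radius p X \<omega> > k \<and> angle p X \<omega> \<in> A) / b) / elog (T k)) \<longlongrightarrow> \<infinity>) at_top"
    if A: "A \<in> geo_borel p" and "measure N A = 0" for A b
  proof (rule tendsto_eventually)
    show "\<forall>\<^sub>F k in at_top. elog (\<P>(\<omega> in M. radius p X \<omega> > k \<and> angle p X \<omega> \<in> A) / b) / elog (T k) = \<infinity>"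
      using elog_joint[OF A] order_tendstoD(2)[OF T_lim zero_less_one]
      by eventually_elim (use T_pos that(2) elog_0_ratio in simp)
  qed
  have g_pos: "((\<lambda>k. g_quot M p X k A) \<longlongrightarrow> 1) at_top" if "A \<in> geo_borel p" "0 < measure N A" for A
    using ratio_pos[OF that, of 1] by (simp add: g_quot_def T_def)
  have g_zero: "((\<lambda>k. g_quot M p X k A) \<longlongrightarrow> \<infinity>) at_top" if "A \<in> geo_borel p" "measure N A = 0" for A
    using ratio_zero[OF that, of 1] by (simp add: g_quot_def T_def)
  have ball: "geo_ball p x \<epsilon> \<in> geo_borel p" for x :: "real^'n" and \<epsilon>
    by (intro openin_geo_borel openin_geo_ball)

  \<comment> \<open>The set \<open>S\<close> as the support of \<open>N\<close>\<close>
  have "(0 < \<P>(\<omega> in M. angle p X \<omega> \<in> A) \<and>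
        ((\<lambda>k. elog \<P>(\<omega> in M. radius p X \<omega> > k \<bar> angle p X \<omega> \<in> A) / elog (T k)) \<longlongrightarrow> 1) at_top)
      \<longleftrightarrow> 0 < measure N A" if A: "A \<in> geo_borel p" for A
  \<comment> \<open>Conditioning on the angle divides by a constant, so for positive mass the limit
    is 1 as for \<open>g\<close>. For mass zero it is \<infinity>, which rules out 1.\<close>
  proof (cases "measure N A = 0")
    case True
    have "\<not> ((\<lambda>k. elog \<P>(\<omega> in M. radius p X \<omega> > k \<bar> angle p X \<omega> \<in> A) / elog (T k)) \<longlongrightarrow> 1) at_top"
    proof
      assume "((\<lambda>k. elog \<P>(\<omega> in M. radius p X \<omega> > k \<bar> angle p X \<omega> \<in> A) / elog (T k)) \<longlongrightarrow> 1) at_top"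
      from tendsto_unique[OF trivial_limit_at_top_linorder this[unfolded cond_prob_def] ratio_zero[OF A True]]
      show False
        by simp
    qed
    then show ?thesis
      using True by simp
  next
    case False
    then have pos: "0 < measure N A"
      by (simp add: less_le)
    have "measure N A \<le> \<P>(\<omega> in M. angle p X \<omega> \<in> A)"
      unfolding N_eq[OF A] using borel[OF A] by (intro finite_measure_mono) auto
    then have "0 < \<P>(\<omega> in M. angle p X \<omega> \<in> A)"
      using pos by linarith
    then show ?thesis
      using ratio_pos[OF A pos] pos unfolding cond_prob_def by simp
  qed
  from this[OF ball] have S_supp: "S_set M p X = supp N"
    unfolding S_set_def supp_def T_def by simp

  \<comment> \<open>Mass of the sphere and of complements\<close>
  have "sphere \<in> geo_borel p"
    using geo.open_in_mspace by (intro openin_geo_borel) (simp add: geo_top_def)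
  \<comment> \<open>Beyond \<open>k1 > 0\<close> the vector is nonzero and can be normalised, so
    \<open>N\<close> is concentrated on the sphere.\<close>
  have "angle p X \<omega> \<in> sphere" if "radius p X \<omega> > k1" for \<omega>
  proof -
    have "0 < lp_norm p (X \<omega>)"
      using that k1(2) by (simp add: radius_def)
    then have "inverse (lp_norm p (X \<omega>)) * lp_norm p (X \<omega>) = 1"
      by (intro left_inverse) linarith
    then show ?thesis
      using p by (simp add: lp_sphere_def angle_def lp_norm_scaleR radius_def)
  qed
  then have "measure N sphere = T k1"
    unfolding N_eq[OF \<open>sphere \<in> geo_borel p\<close>] T_def by (metis (mono_tags, lifting))
  then have N_sphere: "0 < measure N sphere"
    using T_pos by simp
  interpret N: finite_measure N by fact
  have N_Compl: "measure N A + measure N (sphere - A) = measure N sphere" if "A \<in> geo_borel p" "A \<subseteq> sphere" for A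
    using N.finite_measure_Diff[of sphere A] that \<open>sphere \<in> geo_borel p\<close> borel by (simp add: sets_N)

  \<comment> \<open>The testing sets intersected in \<open>S_tilde\<close>\<close>
  have "(\<exists>L L'. ((\<lambda>k. g_quot M p X k A) \<longlongrightarrow> L) at_top \<and>
          ((\<lambda>k. g_quot M p X k (sphere - A)) \<longlongrightarrow> L') at_top \<and> L < L')
      \<longleftrightarrow> measure N (sphere - A) = 0" if "A \<in> testing_sets p" for A
  \<comment> \<open>Each limit is 1 or \<infinity> according to whether the mass is positive or
    zero, so \<open>L < L'\<close> leaves only \<open>L = 1\<close> and
    \<open>L' = \<infinity>\<close>.\<close>
  proof
    have A: "A \<in> geo_borel p" "A \<subseteq> sphere" "sphere - A \<in> geo_borel p"
      using testing_sets_openin[OF that] openin_geo_borel geo_borel_Compl openin_geo_top_iff by blast+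
    {
      assume "\<exists>L L'. ((\<lambda>k. g_quot M p X k A) \<longlongrightarrow> L) at_top \<and>
          ((\<lambda>k. g_quot M p X k (sphere - A)) \<longlongrightarrow> L') at_top \<and> L < L'"
      then obtain L L' where L: "((\<lambda>k. g_quot M p X k A) \<longlongrightarrow> L) at_top"
        "((\<lambda>k. g_quot M p X k (sphere - A)) \<longlongrightarrow> L') at_top" "L < L'"
        by blast
      show "measure N (sphere - A) = 0"
      proof (rule ccontr)
        assume "measure N (sphere - A) \<noteq> 0"
        then have "L' = 1"
          using g_pos[OF A(3)] L(2) tendsto_unique[OF trivial_limit_at_top_linorder] by (metis measure_nonneg order_le_less)
        moreover have "L = 1 \<or> L = \<infinity>"
          using g_pos[OF A(1)] g_zero[OF A(1)] L(1) tendsto_unique[OF trivial_limit_at_top_linorder]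
          by (metis measure_nonneg order_le_less)
        ultimately show False
          using L(3) by auto
      qed
    next
      assume null: "measure N (sphere - A) = 0"
      then have "0 < measure N A"
        using N_Compl[OF A(1,2)] N_sphere by simp
      then show "\<exists>L L'. ((\<lambda>k. g_quot M p X k A) \<longlongrightarrow> L) at_top \<and>
          ((\<lambda>k. g_quot M p X k (sphere - A)) \<longlongrightarrow> L') at_top \<and> L < L'"
        using g_pos[OF A(1)] g_zero[OF A(3) null] by (intro exI[of _ 1] exI[of _ \<infinity>]) auto
    }
  qed
  then have S_core: "S_tilde M p X = tested_core N"
    unfolding S_tilde_def tested_core_def by (intro arg_cong[where f = Inter]) blast

  \<comment> \<open>The closure of the intersection\<close>
  obtain T1 T2 where T1: "openin (geo_top p) T1" and T2: "finite T2" "T2 \<subseteq> sphere"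
    and atoms: "\<And>x. x \<in> T2 \<Longrightarrow> \<exists>m>0. ((\<lambda>k. \<P>(\<omega> in M. angle p X \<omega> \<in> {x} \<bar> radius p X \<omega> > k)) \<longlongrightarrow> m) at_top"
    and form: "supp N = (geo_top p closure_of T1) \<union> T2"
    using A4_form unfolding S_supp by blast
  have "0 < measure N {x}" if x_T2: "x \<in> T2" for x
  proof -
    have "closedin (geo_top p) {x}"
      using T2(2) that t1_space_closedin_singleton[of "geo_top p :: (real^'n) topology"] t1_space_geo_top by auto
    then have x: "{x} \<in> geo_borel p"
      by (rule closedin_geo_borel)
    obtain m where m: "0 < m" "((\<lambda>k. \<P>(\<omega> in M. angle p X \<omega> \<in> {x} \<bar> radius p X \<omega> > k)) \<longlongrightarrow> m) at_top"
      using atoms[OF x_T2] by blast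
    \<comment> \<open>The conditional probability of the atom is constant beyond \<open>k0\<close>,
      so its positive limit \<open>m\<close> is this constant.\<close>
    moreover have "((\<lambda>k. \<P>(\<omega> in M. angle p X \<omega> \<in> {x} \<bar> radius p X \<omega> > k)) \<longlongrightarrow> measure N {x} / T k1) at_top"
      by (rule tendsto_eventually) (rule eventually_mono[OF eventually_gt_at_top[of k0] cond[OF x]])
    ultimately have "0 < measure N {x} / T k1"
      using tendsto_unique[OF trivial_limit_at_top_linorder] by blast
    then show ?thesis
      using T_pos[of k1] by (simp add: zero_less_divide_iff)
  qed
  then have closure: "geo_top p closure_of (tested_core N) = supp N"
    using closure_tested_core_eq_supp[OF fin sets_N T1 T2 _ form] by blast

  \<comment> \<open>Enlargements\<close>
  have "((\<lambda>k. g_quot M p X k (geo_enlarge p \<delta> (tested_core N))) \<longlongrightarrow> 1) at_top"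
    "((\<lambda>k. g_quot M p X k (sphere - geo_enlarge p \<delta> (tested_core N))) \<longlongrightarrow> \<infinity>) at_top" if "0 < \<delta>" for \<delta>
  proof -
    let ?A = "geo_enlarge p \<delta> (tested_core N)"
    have "tested_core N \<subseteq> sphere"
      unfolding tested_core_def using sphere_testing_set by force
    then have A: "openin (geo_top p) ?A"
      by (rule openin_geo_enlarge)
    have closed: "closedin (geo_top p) (sphere - ?A)"
      using A by (metis closedin_diff closedin_topspace topspace_geo_top)
    \<comment> \<open>The enlargement contains the closure of the intersection, which is the
      support; its complement is therefore closed and misses the support.\<close>
    have null: "measure N (sphere - ?A) = 0"
      using closure_subset_geo_enlarge[OF \<open>0 < \<delta>\<close>, of "tested_core N"] closure
      by (intro measure_closed_disjoint_supp[OF fin sets_N closed]) blast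
    then have "0 < measure N ?A"
      using N_Compl[OF openin_geo_borel[OF A]] A N_sphere by (simp add: openin_geo_top_iff)
    then show "((\<lambda>k. g_quot M p X k ?A) \<longlongrightarrow> 1) at_top"
      by (rule g_pos[OF openin_geo_borel[OF A]])
    show "((\<lambda>k. g_quot M p X k (sphere - ?A)) \<longlongrightarrow> \<infinity>) at_top"
      by (rule g_zero[OF closedin_geo_borel[OF closed] null])
  qed
  then show ?thesis
    unfolding S_core S_supp closure by (auto intro!: exI[of _ \<infinity>])
qed

end
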